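(* Let $\vec S$ be a finite universe of separations with an injective and structurally submodular order function $s\mapsto|s|$. Let $\mathcal F$ be a set that includes $\mathcal R(\vec S)$ and is rich and standard for $\vec S_k$ for every $k\in\mathbb R$. Then there exists a tree of the $\mathcal F$-tangles in $\vec S$, i.e. a nested set $N\subseteq S$ such that every two distinct maximal $\mathcal F$-tangles in $\vec S$ are distinguished optimally by a separation in $N$.
   Context: A universe of separations is a set $\vec S$ with a partial order $\le$ making it a lattice (supremum $\vee$, infimum $\wedge$) and an order-reversing involution $\vec s\mapsto\vec s^{\,*}=:\overleftarrow s$; $S=\{\{\vec s,\overleftarrow s\}\}$. The order function on $S$ is extended by $|\vec s|=|\overleftarrow s|=|s|$; it is structurally submodular if for all $\vec r,\vec s$, $|\vec r\vee\vec s|\le|\vec r|$ or $|\vec r\wedge\vec s|\le|\vec s|$. For $k\in\mathbb R$: $\vec S_k=\{\vec s:|s|<k\}$ (a separation system with induced order and involution), $S_k$ its unoriented separations. $\vec s$ is degenerate if $\vec s=\overleftarrow s$; $\vec s$ is trivial in $\vec S_k$ if some $t\in S_k$ has $\vec t<\vec s$ and $\overleftarrow t<\vec s$. Separations are nested if they have comparable orientations. A set $\sigma$ is consistent if there are no $\vec r,\vec s\in\sigma$ with $r\ne s$ and $\vec r<\overleftarrow s$. An $\mathcal F$-tangle of $S_k$ is a consistent set containing exactly one orientation of each element of $S_k$ (and nothing else), none of whose subsets lies in $\mathcal F$; these are the $\mathcal F$-tangles in $\vec S$. An $\mathcal F$-tangle $\tau$ of $S_k$ is maximal in $\vec S$ if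 there is no $\mathcal F$-tangle $\tau'\ne\tau$ of any $S_\ell$ with $\tau=\tau'\cap\vec S_k$. A separation $s\in S$ distinguishes two such partial orientations if both contain an orientation of $s$ and these differ; it distinguishes them optimally if moreover no separation in $S$ of lower order distinguishes them. $\mathcal R(\vec S):=\{\{\vec r,\overleftarrow r\vee\vec s,\overleftarrow r\vee\overleftarrow s\}\subseteq\vec S: r,s\in S,\ |\overleftarrow r\vee\vec s|,|\overleftarrow r\vee\overleftarrow s|<|r|\}$. $\mathcal F$ is standard for $\vec S_k$ if $\{\overleftarrow s\}\in\mathcal F$ for every $\vec s$ trivial in $\vec S_k$. $\vec s$ is weakly eclipsed by $\vec r$ if $\vec r<\vec s$ and $|r|\le|s|$; $\sigma\subseteq\tau$ is strongly efficient in $\tau$ if no element of $\sigma$ is weakly eclipsed by another element of $\tau$. $\mathcal F$ is rich for $\vec S_k$ if every consistent orientation of $S_k$ having a subset in $\mathcal F$ has a strongly efficient such subset. *)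

theory Defs
  imports Complex_Main
begin

text \<open>
  The oriented separations of a universe are the elements of a lattice-ordered type, with the
  order-reversing involution \<open>star\<close> as an explicit parameter. An unoriented separation is a set
  \<open>{s, star s}\<close> (a singleton if \<open>s\<close> is degenerate), and the order function \<open>ord\<close> lives on
  unoriented separations; its values outside \<open>seps star\<close> are never used.
\<close>

definition separation_universe :: "('a::lattice \<Rightarrow> 'a) \<Rightarrow> bool" where
  "separation_universe star \<longleftrightarrow>
     (\<forall>s. star (star s) = s) \<and> (\<forall>r s. r \<le> s \<longrightarrow> star s \<le> star r)"

definition unor :: "('a \<Rightarrow> 'a) \<Rightarrow> 'a \<Rightarrow> 'a set" where
  "unor star s = {s, star s}"

definition seps :: "('a \<Rightarrow> 'a) \<Rightarrow> 'a set set" where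
  "seps star = range (unor star)"

definition oord :: "('a \<Rightarrow> 'a) \<Rightarrow> ('a set \<Rightarrow> real) \<Rightarrow> 'a \<Rightarrow> real" where
  "oord star ord s = ord (unor star s)"

definition structurally_submodular ::
    "('a::lattice \<Rightarrow> 'a) \<Rightarrow> ('a set \<Rightarrow> real) \<Rightarrow> bool" where
  "structurally_submodular star ord \<longleftrightarrow>
     (\<forall>r s. oord star ord (sup r s) \<le> oord star ord r \<or> oord star ord (inf r s) \<le> oord star ord s)"

definition oseps_below :: "('a \<Rightarrow> 'a) \<Rightarrow> ('a set \<Rightarrow> real) \<Rightarrow> real \<Rightarrow> 'a set" where
  "oseps_below star ord k = {s. oord star ord s < k}"

definition seps_below :: "('a \<Rightarrow> 'a) \<Rightarrow> ('a set \<Rightarrow> real) \<Rightarrow> real \<Rightarrow> 'a set set" where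
  "seps_below star ord k = {x \<in> seps star. ord x < k}"

definition trivial_in ::
    "('a::lattice \<Rightarrow> 'a) \<Rightarrow> ('a set \<Rightarrow> real) \<Rightarrow> real \<Rightarrow> 'a \<Rightarrow> bool" where
  "trivial_in star ord k s \<longleftrightarrow>
     s \<in> oseps_below star ord k \<and> (\<exists>t \<in> oseps_below star ord k. t < s \<and> star t < s)"

definition nested :: "'a::lattice set \<Rightarrow> 'a set \<Rightarrow> bool" where
  "nested x y \<longleftrightarrow> (\<exists>r\<in>x. \<exists>s\<in>y. r \<le> s \<or> s \<le> r)"

definition nested_set :: "'a::lattice set set \<Rightarrow> bool" where
  "nested_set N \<longleftrightarrow> (\<forall>x\<in>N. \<forall>y\<in>N. nested x y)"

text \<open>
  In this convention the lattice order is dual to the one most common for tangles: consistency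
  forbids \<open>r < star s\<close> (rather than \<open>star s < r\<close>), and trivial separations are large.
\<close>

definition consistent :: "('a::lattice \<Rightarrow> 'a) \<Rightarrow> 'a set \<Rightarrow> bool" where
  "consistent star \<sigma> \<longleftrightarrow> \<not> (\<exists>r\<in>\<sigma>. \<exists>s\<in>\<sigma>. unor star r \<noteq> unor star s \<and> r < star s)"

definition orientation_of ::
    "('a \<Rightarrow> 'a) \<Rightarrow> ('a set \<Rightarrow> real) \<Rightarrow> real \<Rightarrow> 'a set \<Rightarrow> bool" where
  "orientation_of star ord k \<tau> \<longleftrightarrow>
     \<tau> \<subseteq> oseps_below star ord k \<and> (\<forall>x\<in>seps_below star ord k. \<exists>!s. s \<in> x \<and> s \<in> \<tau>)"

definition tangle_of ::
    "('a::lattice \<Rightarrow> 'a) \<Rightarrow> ('a set \<Rightarrow> real) \<Rightarrow> 'a set set \<Rightarrow> real \<Rightarrow> 'a set \<Rightarrow> bool" where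
  "tangle_of star ord F k \<tau> \<longleftrightarrow>
     orientation_of star ord k \<tau> \<and> consistent star \<tau> \<and> \<not> (\<exists>\<sigma>\<subseteq>\<tau>. \<sigma> \<in> F)"

definition maximal_tangle ::
    "('a::lattice \<Rightarrow> 'a) \<Rightarrow> ('a set \<Rightarrow> real) \<Rightarrow> 'a set set \<Rightarrow> 'a set \<Rightarrow> bool" where
  "maximal_tangle star ord F \<tau> \<longleftrightarrow>
     (\<exists>k. tangle_of star ord F k \<tau> \<and>
        \<not> (\<exists>l \<tau>'. tangle_of star ord F l \<tau>' \<and> \<tau>' \<noteq> \<tau> \<and> \<tau> = \<tau>' \<inter> oseps_below star ord k))"

definition distinguishes :: "'a set \<Rightarrow> 'a set \<Rightarrow> 'a set \<Rightarrow> bool" where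
  "distinguishes x \<tau> \<tau>' \<longleftrightarrow> (\<exists>r\<in>x. \<exists>r'\<in>x. r \<in> \<tau> \<and> r' \<in> \<tau>' \<and> r \<noteq> r')"

definition distinguishes_optimally ::
    "('a \<Rightarrow> 'a) \<Rightarrow> ('a set \<Rightarrow> real) \<Rightarrow> 'a set \<Rightarrow> 'a set \<Rightarrow> 'a set \<Rightarrow> bool" where
  "distinguishes_optimally star ord x \<tau> \<tau>' \<longleftrightarrow>
     x \<in> seps star \<and> distinguishes x \<tau> \<tau>' \<and>
     \<not> (\<exists>y\<in>seps star. ord y < ord x \<and> distinguishes y \<tau> \<tau>')"

definition R_sets :: "('a::lattice \<Rightarrow> 'a) \<Rightarrow> ('a set \<Rightarrow> real) \<Rightarrow> 'a set set" where
  "R_sets star ord = {{r, sup (star r) s, sup (star r) (star s)} | r s.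
     oord star ord (sup (star r) s) < oord star ord r \<and>
     oord star ord (sup (star r) (star s)) < oord star ord r}"

definition standard_for ::
    "('a::lattice \<Rightarrow> 'a) \<Rightarrow> ('a set \<Rightarrow> real) \<Rightarrow> 'a set set \<Rightarrow> real \<Rightarrow> bool" where
  "standard_for star ord F k \<longleftrightarrow> (\<forall>s. trivial_in star ord k s \<longrightarrow> {star s} \<in> F)"

definition weakly_eclipsed ::
    "('a::lattice \<Rightarrow> 'a) \<Rightarrow> ('a set \<Rightarrow> real) \<Rightarrow> 'a \<Rightarrow> 'a \<Rightarrow> bool" where
  "weakly_eclipsed star ord s r \<longleftrightarrow> r < s \<and> oord star ord r \<le> oord star ord s"

definition strongly_efficient ::
    "('a::lattice \<Rightarrow> 'a) \<Rightarrow> ('a set \<Rightarrow> real) \<Rightarrow> 'a set \<Rightarrow> 'a set \<Rightarrow> bool" where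
  "strongly_efficient star ord \<sigma> \<tau> \<longleftrightarrow>
     \<sigma> \<subseteq> \<tau> \<and> \<not> (\<exists>s\<in>\<sigma>. \<exists>r\<in>\<tau>. weakly_eclipsed star ord s r)"

definition rich_for ::
    "('a::lattice \<Rightarrow> 'a) \<Rightarrow> ('a set \<Rightarrow> real) \<Rightarrow> 'a set set \<Rightarrow> real \<Rightarrow> bool" where
  "rich_for star ord F k \<longleftrightarrow>
     (\<forall>\<tau>. orientation_of star ord k \<tau> \<and> consistent star \<tau> \<and> (\<exists>\<sigma>\<subseteq>\<tau>. \<sigma> \<in> F) \<longrightarrow>
        (\<exists>\<sigma>\<subseteq>\<tau>. \<sigma> \<in> F \<and> strongly_efficient star ord \<sigma> \<tau>))"

definition tree_of_tangles ::
    "('a::lattice \<Rightarrow> 'a) \<Rightarrow> ('a set \<Rightarrow> real) \<Rightarrow> 'a set set \<Rightarrow> 'a set set \<Rightarrow> bool" where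
  "tree_of_tangles star ord F N \<longleftrightarrow>
     N \<subseteq> seps star \<and> nested_set N \<and>
     (\<forall>\<tau> \<tau>'. maximal_tangle star ord F \<tau> \<and> maximal_tangle star ord F \<tau>' \<and> \<tau> \<noteq> \<tau>' \<longrightarrow>
        (\<exists>x\<in>N. distinguishes_optimally star ord x \<tau> \<tau>'))"

end

theory Submission
  imports Defs
begin

text \<open>
  Since the order function is injective, each pair of distinguishable tangles has exactly one
  optimal distinguisher, and \<open>N\<close> has to consist of these. Let \<open>r\<close> and \<open>s\<close> be two of them, with
  \<open>|r| < |s|\<close> and \<open>s\<close> distinguishing \<open>\<tau>\<close> and \<open>\<tau>'\<close>, so that both contain the same orientation
  of \<open>r\<close>, say \<open>r\<close> itself. If \<open>r\<close> and \<open>s\<close> cross, then both corners \<open>r \<and> s\<close> and \<open>r \<and> s*\<close> have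
  order greater than \<open>|s|\<close>: otherwise alternating structural submodularity with the exclusion of
  \<open>R_sets\<close> makes \<open>r* \<or> s\<close> and \<open>r* \<or> s*\<close> elements of \<open>\<tau>\<close> of order less than \<open>|r|\<close>,
  which together with \<open>r\<close> form an excluded triple. By submodularity \<open>r \<or> s\<close> and \<open>r \<or> s*\<close> then
  have order less than \<open>|r|\<close>, so the two tangles that \<open>r\<close> distinguishes optimally both contain
  them, and the one containing \<open>r*\<close> has an excluded triple.
\<close>

locale ordered_universe =
  fixes star :: "'a::lattice \<Rightarrow> 'a"
    and ord :: "'a set \<Rightarrow> real"
    and F :: "'a set set"
  assumes universe: "separation_universe star"
    and inj: "inj_on ord (seps star)"
    and submod: "structurally_submodular star ord"
    and R_sets_F: "R_sets star ord \<subseteq> F"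
begin

abbreviation osize :: "'a \<Rightarrow> real" where
  "osize \<equiv> oord star ord"

abbreviation crossing :: "'a \<Rightarrow> 'a \<Rightarrow> bool" where
  "crossing r s \<equiv> \<not> nested (unor star r) (unor star s)"

abbreviation tangle :: "real \<Rightarrow> 'a set \<Rightarrow> bool" where
  "tangle \<equiv> tangle_of star ord F"

section \<open>Involution, corners and their orders\<close>

lemma star_star [simp]: "star (star s) = s"
  using universe by (simp add: separation_universe_def)

lemma star_antimono: "r \<le> s \<Longrightarrow> star s \<le> star r"
  using universe by (simp add: separation_universe_def)

lemma star_sup: "star (sup a b) = inf (star a) (star b)"
proof (rule antisym)
  show "star (sup a b) \<le> inf (star a) (star b)"
    by (simp add: star_antimono)
  have "sup a b \<le> star (inf (star a) (star b))"
    using star_antimono[of "inf (star a) (star b)" "star a"]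
      star_antimono[of "inf (star a) (star b)" "star b"] by simp
  then show "inf (star a) (star b) \<le> star (sup a b)"
    using star_antimono by fastforce
qed

lemma unor_star [simp]: "unor star (star s) = unor star s"
  by (auto simp: unor_def)

lemma osize_star [simp]: "osize (star s) = osize s"
  by (simp add: oord_def)

lemma osize_inf: "osize (inf a b) = osize (sup (star a) (star b))"
  using osize_star[of "sup (star a) (star b)"] by (simp add: star_sup)

lemma osize_eqD: "osize a = osize b \<Longrightarrow> a = b \<or> a = star b"
  using inj unfolding inj_on_def seps_def oord_def
  by (metis insertCI insertE rangeI singletonD unor_def)

text \<open>De Morgan under the involution turns the infimum in submodularity into a supremum, the
  form in which corners occur in \<open>R_sets\<close>.\<close>

lemma osize_sup_or_inf:
  "osize (sup r s) \<le> osize r \<or> osize (sup (star r) (star s)) \<le> osize s"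
  using submod by (simp add: structurally_submodular_def osize_inf[symmetric])

lemma crossing_sym: "crossing r s \<Longrightarrow> crossing s r"
  by (auto simp: nested_def)

text \<open>Equality would, by injectivity, make \<open>sup r s\<close> an orientation of one of the
  two separations, with an orientation of the other below it. Weak bounds on the corners of crossing
  separations thereby become strict.\<close>

lemma crossing_osize_sup:
  assumes "crossing r s"
  shows "osize (sup r s) \<noteq> osize r" "osize (sup r s) \<noteq> osize s"
proof -
  have *: "osize (sup a b) \<noteq> osize a" if "crossing a b" for a b
  proof
    assume "osize (sup a b) = osize a"
    then have "sup a b = a \<or> sup a b = star a" by (rule osize_eqD)
    then have "b \<le> a \<or> b \<le> star a" by (metis sup_ge2)
    with that show False by (auto simp: nested_def unor_def)
  qed
  show "osize (sup r s) \<noteq> osize r" using *[OF assms] .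
  show "osize (sup r s) \<noteq> osize s" using *[OF crossing_sym[OF assms]] by (simp add: sup_commute)
qed

section \<open>Closure properties of tangles\<close>

lemma tangle_osize: "tangle k \<tau> \<Longrightarrow> a \<in> \<tau> \<Longrightarrow> osize a < k"
  by (auto simp: tangle_of_def orientation_of_def oseps_below_def)

lemma tangle_orients:
  assumes "tangle k \<tau>" "osize a < k"
  shows "\<exists>!s. s \<in> unor star a \<and> s \<in> \<tau>"
  using assms by (auto simp: tangle_of_def orientation_of_def seps_below_def seps_def oord_def)

lemma tangle_cases: "tangle k \<tau> \<Longrightarrow> osize a < k \<Longrightarrow> a \<in> \<tau> \<or> star a \<in> \<tau>"
  using tangle_orients by (fastforce simp: unor_def)

text \<open>If \<open>star b\<close> were in the tangle, \<open>a < star (star b)\<close> would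
  violate consistency. Consistency only restricts orientations of different separations, which the
  inequality of orders ensures.\<close>

lemma tangle_upward_closed:
  assumes "tangle k \<tau>" "a \<in> \<tau>" "a \<le> b" "osize b < k" "osize a \<noteq> osize b"
  shows "b \<in> \<tau>"
proof (rule ccontr)
  assume "b \<notin> \<tau>"
  then have "star b \<in> \<tau>" using assms tangle_cases by blast
  moreover have "unor star a \<noteq> unor star b" "a < b"
    using assms by (auto simp: oord_def less_le)
  moreover have "consistent star \<tau>" using assms by (simp add: tangle_of_def)
  ultimately show False
    using assms(2) unfolding consistent_def by (metis star_star unor_star)
qed

lemma tangle_avoids_R:
  assumes "tangle k \<tau>" "r \<in> \<tau>" "sup (star r) s \<in> \<tau>" "sup (star r) (star s) \<in> \<tau>"
    "osize (sup (star r) s) < osize r" "osize (sup (star r) (star s)) < osize r"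
  shows False
proof -
  have "{r, sup (star r) s, sup (star r) (star s)} \<in> F"
    using assms(5,6) R_sets_F by (auto simp: R_sets_def)
  moreover have "{r, sup (star r) s, sup (star r) (star s)} \<subseteq> \<tau>" using assms by simp
  ultimately show False using assms(1) unfolding tangle_of_def by blast
qed

lemma tangle_sup:
  assumes "tangle k \<tau>" "a \<in> \<tau>" "osize (sup a b) < k" "osize (sup a b) \<noteq> osize a"
  shows "sup a b \<in> \<tau>" "sup b a \<in> \<tau>"
  using tangle_upward_closed[OF assms(1,2) sup_ge1 assms(3)] assms(4) by (simp_all add: sup_commute)

section \<open>Corners of crossing separations\<close>

lemma corner_osize_gt:
  assumes t: "tangle k \<tau>" and t': "tangle k' \<tau>'"
    and agree: "\<And>a. osize a < osize s \<Longrightarrow> a \<in> \<tau> \<longleftrightarrow> a \<in> \<tau>'"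
    and s: "s \<in> \<tau>" "star s \<in> \<tau>'" and r: "r \<in> \<tau>" "osize r < osize s"
    and cr: "crossing r s"
  shows "osize (sup (star r) (star s)) > osize s"
proof (rule ccontr)
  have ne: "osize (sup r s) \<noteq> osize r" "osize (sup r s) \<noteq> osize s"
    "osize (sup (star r) s) \<noteq> osize r" "osize (sup (star r) s) \<noteq> osize s"
    "osize (sup r (star s)) \<noteq> osize r" "osize (sup r (star s)) \<noteq> osize s"
    "osize (sup (star r) (star s)) \<noteq> osize r" "osize (sup (star r) (star s)) \<noteq> osize s"
    using crossing_osize_sup[of r s] crossing_osize_sup[of "star r" s]
      crossing_osize_sup[of r "star s"] crossing_osize_sup[of "star r" "star s"] cr by simp_all
  have sk: "osize s < k" "osize s < k'"
    using tangle_osize[OF t s(1)] tangle_osize[OF t' s(2)] by simp_all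
  have r': "r \<in> \<tau>'" using agree r by blast
  assume "\<not> ?thesis"
  then have c1: "osize (sup (star r) (star s)) < osize s" using ne by linarith
  \<comment> \<open>This corner lies above \<open>star s\<close>. Its order is below that of
    \<open>s\<close>, so \<open>agree\<close> later moves it to \<tau> as well.\<close>
  then have m1: "sup (star r) (star s) \<in> \<tau>'"
    using tangle_sup(2)[OF t' s(2), of "star r"] sk ne by (simp add: sup_commute)
  \<comment> \<open>Otherwise both corners above \<open>star s\<close> would lie in \<tau> and form
    an excluded triple with \<open>s\<close>.\<close>
  have "osize (sup r (star s)) > osize s"
  proof (rule ccontr)
    assume "\<not> ?thesis"
    then have c: "osize (sup r (star s)) < osize s" using ne by linarith
    then have "sup r (star s) \<in> \<tau>" using tangle_sup(1)[OF t r(1), of "star s"] sk ne by simp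
    then show False
      using tangle_avoids_R[OF t s(1), of r] c c1 m1 agree by (simp add: sup_commute)
  qed
  then have c2: "osize (sup (star r) s) < osize r"
    using osize_sup_or_inf[of "star r" s] ne by simp
  then have m2: "sup (star r) s \<in> \<tau>"
    using tangle_sup(2)[OF t s(1), of "star r"] sk r ne by (simp add: sup_commute)
  \<comment> \<open>The mirror argument in \<tau>': here the triple would consist of
    \<open>star s\<close> and the two corners above \<open>s\<close>.\<close>
  have "osize (sup r s) > osize s"
  proof (rule ccontr)
    assume "\<not> ?thesis"
    then have c: "osize (sup r s) < osize s" using ne by linarith
    then have "sup r s \<in> \<tau>'" using tangle_sup(1)[OF t' r', of s] sk ne by simp
    then show False
      using tangle_avoids_R[OF t' s(2), of r] c c2 r m2 agree by (simp add: sup_commute)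
  qed
  then have c3: "osize (sup (star r) (star s)) < osize r"
    using osize_sup_or_inf[of "star r" "star s"] ne by simp
  show False
    using tangle_avoids_R[OF t r(1) m2 _ c2 c3] m1 c1 agree by blast
qed

lemma optimal_distinguishers_cross_free:
  assumes t: "tangle k \<tau>" and t': "tangle k' \<tau>'"
    and agree: "\<And>a. osize a < osize s \<Longrightarrow> a \<in> \<tau> \<longleftrightarrow> a \<in> \<tau>'"
    and s: "s \<in> \<tau>" "star s \<in> \<tau>'" and r: "r \<in> \<tau>" "osize r < osize s"
    and p: "tangle l \<rho>" and p': "tangle l' \<rho>'"
    and agree': "\<And>a. osize a < osize r \<Longrightarrow> a \<in> \<rho> \<longleftrightarrow> a \<in> \<rho>'"
    and rp: "r \<in> \<rho>" "star r \<in> \<rho>'"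
  shows "nested (unor star r) (unor star s)"
proof (rule ccontr)
  assume cr: "crossing r s"
  have ne: "osize (sup r s) \<noteq> osize r" "osize (sup r (star s)) \<noteq> osize r"
    using crossing_osize_sup(1)[of r s] crossing_osize_sup(1)[of r "star s"] cr by simp_all
  have "osize (sup (star r) (star s)) > osize s"
    using corner_osize_gt[OF t t' agree s r cr] .
  then have c1: "osize (sup r s) < osize r"
    using osize_sup_or_inf[of r s] ne by simp
  \<comment> \<open>The hypotheses are symmetric under exchanging the two tangles and reversing
    \<open>s\<close>.\<close>
  have "osize (sup (star r) s) > osize s"
    using corner_osize_gt[OF t' t, of "star s" r] agree s r cr by simp
  then have c2: "osize (sup r (star s)) < osize r"
    using osize_sup_or_inf[of r "star s"] ne by simp
  have "sup r s \<in> \<rho>" "sup r (star s) \<in> \<rho>"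
    using tangle_sup(1)[OF p rp(1)] c1 c2 tangle_osize[OF p rp(1)] by simp_all
  then show False
    using tangle_avoids_R[OF p' rp(2), of s] c1 c2 agree' by simp
qed

section \<open>Optimal distinguishers of tangles\<close>

lemma distinguishes_unor:
  assumes "x \<in> seps star" "distinguishes x \<tau> \<tau>'"
  obtains s where "x = unor star s" "s \<in> \<tau>" "star s \<in> \<tau>'"
proof -
  obtain a where a: "x = unor star a" using assms by (auto simp: seps_def)
  from assms(2) a have "a \<in> \<tau> \<and> star a \<in> \<tau>' \<or> star a \<in> \<tau> \<and> a \<in> \<tau>'"
    by (auto simp: distinguishes_def unor_def)
  then show thesis using that[of a] that[of "star a"] a by auto
qed

lemma distinguishes_optimally_sym:
  "distinguishes_optimally star ord x \<tau> \<tau>' \<Longrightarrow> distinguishes_optimally star ord x \<tau>' \<tau>"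
  unfolding distinguishes_optimally_def distinguishes_def by metis

text \<open>Tangles that orient \<open>x\<close> orient everything of lower order, so a disagreement
  on \<open>a\<close> would yield a distinguisher of lower order than \<open>x\<close>.\<close>

lemma distinguishes_optimally_agree:
  assumes "tangle k \<tau>" "tangle k' \<tau>'" "distinguishes_optimally star ord x \<tau> \<tau>'"
    and a: "osize a < ord x"
  shows "a \<in> \<tau> \<longleftrightarrow> a \<in> \<tau>'"
proof -
  have imp: "a \<in> \<upsilon>'"
    if t: "tangle l \<upsilon>" "tangle l' \<upsilon>'" and d: "distinguishes_optimally star ord x \<upsilon> \<upsilon>'"
      and "a \<in> \<upsilon>" for l l' \<upsilon> \<upsilon>'
  proof (rule ccontr)
    assume "a \<notin> \<upsilon>'"
    obtain s where "x = unor star s" "star s \<in> \<upsilon>'"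
      using d distinguishes_unor unfolding distinguishes_optimally_def by metis
    then have "osize a < l'" using a tangle_osize[OF t(2), of "star s"] by (simp add: oord_def)
    then have "star a \<in> \<upsilon>'" using t \<open>a \<notin> \<upsilon>'\<close> tangle_cases by blast
    then have "distinguishes (unor star a) \<upsilon> \<upsilon>'"
      using \<open>a \<in> \<upsilon>\<close> \<open>a \<notin> \<upsilon>'\<close> by (auto simp: distinguishes_def unor_def)
    then show False
      using d a by (auto simp: distinguishes_optimally_def seps_def oord_def)
  qed
  show ?thesis
    using imp[OF assms(1-3)] imp[OF assms(2,1) distinguishes_optimally_sym[OF assms(3)]] by blast
qed

lemma optimal_distinguishers_nested_less:
  assumes p: "tangle l \<rho>" "tangle l' \<rho>'" and x: "distinguishes_optimally star ord x \<rho> \<rho>'"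
    and t: "tangle k \<tau>" "tangle k' \<tau>'" and y: "distinguishes_optimally star ord y \<tau> \<tau>'"
    and less: "ord x < ord y"
  shows "nested x y"
proof -
  obtain r where r: "x = unor star r" "r \<in> \<rho>" "star r \<in> \<rho>'"
    using x distinguishes_unor unfolding distinguishes_optimally_def by metis
  obtain s where s: "y = unor star s" "s \<in> \<tau>" "star s \<in> \<tau>'"
    using y distinguishes_unor unfolding distinguishes_optimally_def by metis
  have sizes: "ord x = osize r" "ord y = osize s" using r s by (simp_all add: oord_def)
  note agree_x = distinguishes_optimally_agree[OF p x, unfolded sizes]
  note agree_y = distinguishes_optimally_agree[OF t y, unfolded sizes]
  have rs: "osize r < osize s" using less sizes by simp
  then have "r \<in> \<tau> \<or> star r \<in> \<tau>"
    using tangle_cases[OF t(1), of r] tangle_osize[OF t(1) s(2)] by simp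
  then show ?thesis
  proof
    assume "r \<in> \<tau>"
    then show ?thesis
      using optimal_distinguishers_cross_free[OF t agree_y s(2,3) _ rs p agree_x r(2,3)] r s
      by simp
  next
    \<comment> \<open>Exchanging \<rho> and \<rho>' gives \<open>star r\<close> the role that
      \<open>r\<close> has in the first case.\<close>
    assume "star r \<in> \<tau>"
    then show ?thesis
      using optimal_distinguishers_cross_free[OF t agree_y s(2,3) _ _ p(2,1), of "star r"]
        agree_x r s rs by simp
  qed
qed

lemma optimal_distinguishers_nested:
  assumes "tangle l \<rho>" "tangle l' \<rho>'" "distinguishes_optimally star ord x \<rho> \<rho>'"
    and "tangle k \<tau>" "tangle k' \<tau>'" "distinguishes_optimally star ord y \<tau> \<tau>'"
  shows "nested x y"
proof -
  have seps: "x \<in> seps star" "y \<in> seps star"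
    using assms by (simp_all add: distinguishes_optimally_def)
  consider "ord x < ord y" | "ord y < ord x" | "ord x = ord y" by linarith
  then show ?thesis
  proof cases
    case 1
    then show ?thesis using optimal_distinguishers_nested_less assms by blast
  next
    case 2
    then have "nested y x" using optimal_distinguishers_nested_less assms by blast
    then show ?thesis by (auto simp: nested_def)
  next
    case 3
    then have "x = y" using inj seps by (simp add: inj_on_def)
    then show ?thesis using seps by (auto simp: nested_def seps_def unor_def)
  qed
qed

section \<open>Distinguishing maximal tangles\<close>

lemma undistinguished_tangle_restrict:
  assumes t: "tangle k \<tau>" "tangle l \<tau>'" "k \<le> l"
    and nd: "\<And>x. x \<in> seps star \<Longrightarrow> \<not> distinguishes x \<tau> \<tau>'"
  shows "\<tau> = \<tau>' \<inter> oseps_below star ord k"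
proof -
  have agree: "a = b" if "a \<in> \<tau>" "b \<in> \<tau>'" "b \<in> unor star a" for a b
  proof -
    have "unor star a \<in> seps star" "a \<in> unor star a" by (simp_all add: seps_def unor_def)
    then show ?thesis using nd that unfolding distinguishes_def by blast
  qed
  show ?thesis
  proof (intro set_eqI iffI)
    fix a assume a: "a \<in> \<tau>"
    then have "osize a < k" using t tangle_osize by blast
    moreover then obtain b where "b \<in> unor star a" "b \<in> \<tau>'"
      using tangle_orients[OF t(2), of a] t(3) by auto
    ultimately show "a \<in> \<tau>' \<inter> oseps_below star ord k"
      using agree a by (auto simp: oseps_below_def)
  next
    fix a assume a: "a \<in> \<tau>' \<inter> oseps_below star ord k"
    then obtain b where "b \<in> unor star a" "b \<in> \<tau>"
      using tangle_orients[OF t(1), of a] by (auto simp: oseps_below_def)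
    moreover from this(1) have "a \<in> unor star b" by (auto simp: unor_def)
    ultimately show "a \<in> \<tau>" using agree a by blast
  qed
qed

text \<open>Of two undistinguished tangles, the one with the smaller bound is a restriction of the
  other, against its maximality.\<close>

lemma maximal_tangles_distinguished:
  assumes "maximal_tangle star ord F \<tau>" "maximal_tangle star ord F \<tau>'" "\<tau> \<noteq> \<tau>'"
  shows "\<exists>x\<in>seps star. distinguishes x \<tau> \<tau>'"
proof (rule ccontr)
  assume nd: "\<not> ?thesis"
  then have nd': "\<not> distinguishes x \<tau>' \<tau>" if "x \<in> seps star" for x
    using that unfolding distinguishes_def by metis
  \<comment> \<open>Both facts are taken for the same \<open>k\<close>, since one set can be a
    tangle for several bounds.\<close>
  obtain k where k: "tangle k \<tau>"
    "\<And>l \<upsilon>. tangle l \<upsilon> \<Longrightarrow> \<upsilon> \<noteq> \<tau> \<Longrightarrow> \<tau> \<noteq> \<upsilon> \<inter> oseps_below star ord k"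
    using assms(1) unfolding maximal_tangle_def by blast
  obtain l where l: "tangle l \<tau>'"
    "\<And>k \<upsilon>. tangle k \<upsilon> \<Longrightarrow> \<upsilon> \<noteq> \<tau>' \<Longrightarrow> \<tau>' \<noteq> \<upsilon> \<inter> oseps_below star ord l"
    using assms(2) unfolding maximal_tangle_def by blast
  show False
  proof (cases "k \<le> l")
    case True
    then show False
      using undistinguished_tangle_restrict[OF k(1) l(1)] nd k(2)[OF l(1)] assms(3) by blast
  next
    case False
    then show False
      using undistinguished_tangle_restrict[OF l(1) k(1)] nd' l(2)[OF k(1)] assms(3) by simp
  qed
qed

end

text \<open>Finiteness of the type enters here: it provides a distinguisher of least order.\<close>

lemma ex_distinguishes_optimally:
  fixes star :: "'a::finite \<Rightarrow> 'a"
  assumes "\<exists>x\<in>seps star. distinguishes x \<tau> \<tau>'"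
  shows "\<exists>x. distinguishes_optimally star ord x \<tau> \<tau>'"
proof -
  let ?D = "{x \<in> seps star. distinguishes x \<tau> \<tau>'}"
  have D: "finite ?D" "?D \<noteq> {}" using assms by auto
  obtain x where "is_arg_min ord (\<lambda>x. x \<in> ?D) x"
    using ex_is_arg_min_if_finite[OF D] by blast
  then show ?thesis
    by (auto simp: is_arg_min_def distinguishes_optimally_def)
qed

theorem theorem6p10:
  fixes star :: "'a::{finite,lattice} \<Rightarrow> 'a"
    and ord :: "'a set \<Rightarrow> real"
    and F :: "'a set set"
  assumes "separation_universe star"
    and "inj_on ord (seps star)"
    and "structurally_submodular star ord"
    and "R_sets star ord \<subseteq> F"
    and "\<And>k. rich_for star ord F k"
    and "\<And>k. standard_for star ord F k"
  shows "\<exists>N. tree_of_tangles star ord F N"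
proof -
  interpret ordered_universe star ord F
    using assms(1-4) by unfold_locales
  let ?N = "{x. \<exists>\<tau> \<tau>' k k'. tangle k \<tau> \<and> tangle k' \<tau>' \<and> distinguishes_optimally star ord x \<tau> \<tau>'}"
  have "?N \<subseteq> seps star" by (auto simp: distinguishes_optimally_def)
  moreover have "nested_set ?N"
    unfolding nested_set_def using optimal_distinguishers_nested by blast
  moreover have "\<exists>x\<in>?N. distinguishes_optimally star ord x \<tau> \<tau>'"
    if m: "maximal_tangle star ord F \<tau>" "maximal_tangle star ord F \<tau>'" "\<tau> \<noteq> \<tau>'" for \<tau> \<tau>'
  proof -
    obtain k k' where "tangle k \<tau>" "tangle k' \<tau>'"
      using m unfolding maximal_tangle_def by blast
    then show ?thesis
      using ex_distinguishes_optimally[OF maximal_tangles_distinguished[OF m]] by blast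
  qed
  ultimately have "tree_of_tangles star ord F ?N"
    unfolding tree_of_tangles_def by blast
  then show ?thesis by blast
qed

end
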